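(* Let $G=(V,E)$ be a connected, infinite, locally finite graph with vertex measure $\mu:V\to(0,\infty)$ and symmetric edge measure $w:E\to(0,\infty)$, and let $g,h:V\to\mathbb{R}$ be functions. Assume that at least one of the following two conditions holds: (C-1) $h\in L^1(V)$, $g(x)\le h(x)<0$ for all $x\in V$, and $\int_V\left(\frac{g}{h}\right)^2|h|\,d\mu<+\infty$; (C-2) $G$ (with $\mu$ and $w$) is a Cheeger graph, $g\in L^2(V)$, $h\in L^1(V)$, and $h(x)\le 0$ for all $x\in V$. Then the Kazdan-Warner equation $\Delta f+he^f-g=0$ has a global solution on $G$, i.e. there exists $f:V\to\mathbb{R}$ such that $\Delta f(x)+h(x)e^{f(x)}-g(x)=0$ for every $x\in V$.
   Context: A vertex measure is a map $\mu:V\to(0,\infty)$; an edge measure is a map $w:E\to(0,\infty)$ with $w_{xy}=w_{yx}$ for each edge $x\sim y$. Locally finite means that $\{y: y\sim x\}$ is finite for each vertex $x$. For $f:V\to\mathbb{R}$, the graph Laplacian is $\Delta f(x)=\frac{1}{\mu(x)}\sum_{y\sim x}w_{xy}(f(y)-f(x))$. Integrals are $\int_V f\,d\mu=\sum_{x\in V}f(x)\mu(x)$, and $L^p(V)$ is the space of $p$-th integrable functions with respect to $\mu$. The gradient modulus is $|\nabla f|(x)=\left(\frac{1}{2\mu(x)}\sum_{y\sim x}w_{xy}(f(x)-f(y))^2\right)^{1/2}$. A full subgraph $G'\subset G$ is a subgraph such that vertices $x,y$ of $G'$ are adjacent in $G'$ if and only if they are adjacent in $G$, equipped with the restrictions of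 $\mu$ and $w$. An exhaustion of $G$ is a sequence of finite full subgraphs $G_1,G_2,\dots$ with vertex sets $V_1\subset V_2\subset\cdots$ such that $V=\bigcup_k V_k$. Set $\overline{V_k}=V_k\cup\{x\in V: x\sim y\text{ for some }y\in V_k\}$, let $\overline{G_k}$ be the corresponding full subgraph, and let $\partial V_k=\overline{V_k}\setminus V_k$. $G$ (with $\mu,w$) is a Cheeger graph if there exist an exhaustion $\{G_k\}$ of $G$ and a constant $C(G)>0$ (independent of $k$ and $f$) such that for each $k$ and each function $f:\overline{V_k}\to\mathbb{R}$, not identically zero, with $f|_{\partial V_k}\equiv0$, one has $\|\nabla f\|_{L^2(\overline{V_k})}>C(G)\|f\|_{L^2(\overline{V_k})}$, where $|\nabla f|$ is computed in the graph $\overline{G_k}$ and the norms are with respect to $\mu$ on $\overline{V_k}$. *)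

theory Defs
  imports "HOL-Analysis.Analysis"
begin

text \<open>
  Edges are stored as a symmetric irreflexive relation, so \<open>(x, y) \<in> edges G\<close> is \<open>x \<sim> y\<close>.
  The functions \<open>vmeas G\<close> and \<open>emeas G\<close> are total, but only their values on vertices and on
  edges are meaningful; the same holds for all real functions on the vertex set below.
\<close>

record 'a wgraph =
  verts :: "'a set"
  edges :: "('a \<times> 'a) set"
  vmeas :: "'a \<Rightarrow> real"
  emeas :: "'a \<Rightarrow> 'a \<Rightarrow> real"

definition weighted_graph :: "'a wgraph \<Rightarrow> bool" where
  "weighted_graph G \<longleftrightarrow>
     edges G \<subseteq> verts G \<times> verts G \<and> sym (edges G) \<and> irrefl (edges G) \<and>
     (\<forall>x\<in>verts G. vmeas G x > 0) \<and>
     (\<forall>(x, y)\<in>edges G. emeas G x y > 0 \<and> emeas G x y = emeas G y x)"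

definition nbrs :: "'a wgraph \<Rightarrow> 'a \<Rightarrow> 'a set" where
  "nbrs G x = {y. (x, y) \<in> edges G}"

definition locally_finite_graph :: "'a wgraph \<Rightarrow> bool" where
  "locally_finite_graph G \<longleftrightarrow> (\<forall>x\<in>verts G. finite (nbrs G x))"

definition connected_graph :: "'a wgraph \<Rightarrow> bool" where
  "connected_graph G \<longleftrightarrow> (\<forall>x\<in>verts G. \<forall>y\<in>verts G. (x, y) \<in> (edges G)\<^sup>*)"

definition laplacian :: "'a wgraph \<Rightarrow> ('a \<Rightarrow> real) \<Rightarrow> 'a \<Rightarrow> real" where
  "laplacian G f x = 1 / vmeas G x * (\<Sum>y\<in>nbrs G x. emeas G x y * (f y - f x))"

definition grad_modulus :: "'a wgraph \<Rightarrow> ('a \<Rightarrow> real) \<Rightarrow> 'a \<Rightarrow> real" where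
  "grad_modulus G f x =
     sqrt (1 / (2 * vmeas G x) * (\<Sum>y\<in>nbrs G x. emeas G x y * (f x - f y)\<^sup>2))"

text \<open>
  Sums over \<open>V\<close> are unconditional. For nonnegative \<open>f\<close>, \<open>vintegrable G f\<close> says exactly that the
  integral of \<open>f\<close> is finite (whereas \<open>vintegral\<close> is \<open>0\<close> by convention when the sum diverges).
\<close>

definition vintegrable :: "'a wgraph \<Rightarrow> ('a \<Rightarrow> real) \<Rightarrow> bool" where
  "vintegrable G f \<longleftrightarrow> (\<lambda>x. f x * vmeas G x) summable_on verts G"

definition vintegral :: "'a wgraph \<Rightarrow> ('a \<Rightarrow> real) \<Rightarrow> real" where
  "vintegral G f = (\<Sum>\<^sub>\<infinity>x\<in>verts G. f x * vmeas G x)"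

definition Lp :: "real \<Rightarrow> 'a wgraph \<Rightarrow> ('a \<Rightarrow> real) set" where
  "Lp p G = {f. vintegrable G (\<lambda>x. \<bar>f x\<bar> powr p)}"

definition Lp_norm :: "real \<Rightarrow> 'a wgraph \<Rightarrow> ('a \<Rightarrow> real) \<Rightarrow> real" where
  "Lp_norm p G f = vintegral G (\<lambda>x. \<bar>f x\<bar> powr p) powr (1 / p)"

definition full_subgraph :: "'a wgraph \<Rightarrow> 'a set \<Rightarrow> 'a wgraph" where
  "full_subgraph G W = G\<lparr>verts := W, edges := edges G \<inter> W \<times> W\<rparr>"

text \<open>
  A full subgraph is determined by its vertex set, so an exhaustion is given by the vertex
  sets alone; it is indexed from \<open>0\<close>.
\<close>

definition exhaustion :: "'a wgraph \<Rightarrow> (nat \<Rightarrow> 'a set) \<Rightarrow> bool" where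
  "exhaustion G W \<longleftrightarrow>
     (\<forall>k. finite (W k) \<and> W k \<subseteq> W (Suc k)) \<and> verts G = (\<Union>k. W k)"

definition vclosure :: "'a wgraph \<Rightarrow> 'a set \<Rightarrow> 'a set" where
  "vclosure G W = W \<union> {x \<in> verts G. \<exists>y\<in>W. (x, y) \<in> edges G}"

definition vboundary :: "'a wgraph \<Rightarrow> 'a set \<Rightarrow> 'a set" where
  "vboundary G W = vclosure G W - W"

definition cheeger_graph :: "'a wgraph \<Rightarrow> bool" where
  "cheeger_graph G \<longleftrightarrow>
     (\<exists>W C. exhaustion G W \<and> C > 0 \<and>
       (\<forall>k f. (\<exists>x\<in>vclosure G (W k). f x \<noteq> 0) \<longrightarrow> (\<forall>x\<in>vboundary G (W k). f x = 0) \<longrightarrow>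
          (let H = full_subgraph G (vclosure G (W k))
           in Lp_norm 2 H (grad_modulus H f) > C * Lp_norm 2 H f)))"

end

theory Submission
  imports Defs
begin

text \<open>
  The equation reads \<open>\<Delta>f = F(x, f)\<close> with \<open>F(x, t) = g(x) - h(x) e\<^sup>t\<close>, which is
  nondecreasing in \<open>t\<close> because \<open>h \<le> 0\<close>.  Everything rests on Perron's method: let \<open>K\<close> be
  a nonempty, pointwise bounded family of subsolutions (\<open>\<Delta>f \<ge> F(x, f)\<close>) that is closed
  under maxima and under raising the value at one vertex as long as the inequality at that vertex
  survives.  Then the pointwise supremum of \<open>K\<close> is a solution (\<open>perron_solution\<close>).  The
  analytic content lies in the pointwise bounds, and these come from testing the inequality for a
  finitely supported subsolution \<open>f \<ge> 0\<close> against a nondecreasing function of \<open>f\<close> and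
  summing by parts (\<open>green_identity\<close>).

  Under (C-1) the zero function is a subsolution because \<open>g \<le> h\<close>, so \<open>K\<close> can consist of the finitely
  supported nonnegative subsolutions.  The test function \<open>p = e\<^sup>f - 1\<close> gives
  \<open>\<integral>|h| p\<^sup>2 \<le> \<integral>|h| e\<^sup>f p \<le> \<integral>|g| p\<close>, and Young's inequality bounds
  \<open>\<integral>|h| p\<^sup>2\<close>, hence \<open>f(x)\<close>, by \<open>\<integral>(g/h)\<^sup>2|h|\<close>
  (\<open>exp_subsolution_bound\<close>).

  Under (C-2) the sign of \<open>g\<close> is arbitrary and the linear equation \<open>\<Delta>u = -(|g| + |h|)\<close>
  is solved first, with \<open>u \<ge> 0\<close>.  Here the test function is the truncation
  \<open>m = min f t\<close> at the height \<open>t = f(x)\<close> to be estimated: the Cheeger inequality bounds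
  \<open>C\<^sup>2 \<parallel>m\<parallel>\<^sup>2\<close> by \<open>\<integral>(|g| + |h|) m\<close>, in which the part with
  \<open>h\<close> is at most \<open>t \<parallel>h\<parallel>\<^sub>1\<close>, so that integrability of \<open>h\<close> suffices; on
  the other side \<open>\<parallel>m\<parallel>\<^sup>2 \<ge> t\<^sup>2 \<mu>(x)\<close> grows quadratically in \<open>t\<close>
  (\<open>poisson_subsolution_bound\<close>).  Then \<open>-u\<close> is a subsolution and \<open>u\<close> a supersolution
  of the original equation, and Perron's method between the two gives the solution.
\<close>

section \<open>Subsolutions\<close>

locale locally_finite_weighted_graph =
  fixes G :: "'a wgraph"
  assumes weighted: "weighted_graph G"
    and locally_finite: "locally_finite_graph G"
begin

lemma vmeas_pos: "x \<in> verts G \<Longrightarrow> vmeas G x > 0"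
  using weighted by (auto simp: weighted_graph_def)

lemma emeas_pos: "y \<in> nbrs G x \<Longrightarrow> emeas G x y > 0"
  using weighted by (auto simp: weighted_graph_def nbrs_def)

lemma emeas_sym: "y \<in> nbrs G x \<Longrightarrow> emeas G x y = emeas G y x"
  using weighted by (auto simp: weighted_graph_def nbrs_def)

lemma edge_sym: "(x, y) \<in> edges G \<longleftrightarrow> (y, x) \<in> edges G"
  using weighted by (auto simp: weighted_graph_def sym_def)

lemma finite_nbrs: "x \<in> verts G \<Longrightarrow> finite (nbrs G x)"
  using locally_finite by (auto simp: locally_finite_graph_def)

lemma nbrs_verts: "y \<in> nbrs G x \<Longrightarrow> y \<in> verts G"
  using weighted by (auto simp: weighted_graph_def nbrs_def)

lemma not_in_nbrs_self: "x \<notin> nbrs G x"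
  using weighted by (auto simp: weighted_graph_def nbrs_def irrefl_def)

lemma laplacian_fun_upd:
  "laplacian G (f(x := t)) x = 1 / vmeas G x * (\<Sum>y\<in>nbrs G x. emeas G x y * (f y - t))"
proof -
  have "(\<Sum>y\<in>nbrs G x. emeas G x y * ((f(x := t)) y - (f(x := t)) x)) =
      (\<Sum>y\<in>nbrs G x. emeas G x y * (f y - t))"
    by (rule sum.cong) (use not_in_nbrs_self in auto)
  then show ?thesis
    by (simp add: laplacian_def)
qed

lemma laplacian_mono:
  assumes "x \<in> verts G" "f x = f' x" "\<And>y. y \<in> verts G \<Longrightarrow> f y \<le> f' y"
  shows "laplacian G f x \<le> laplacian G f' x"
  unfolding laplacian_def
  using assms vmeas_pos[of x] emeas_pos[of _ x] nbrs_verts[of _ x]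
  by (intro mult_left_mono sum_mono) (auto intro: less_imp_le)

definition subsolution :: "('a \<Rightarrow> real \<Rightarrow> real) \<Rightarrow> ('a \<Rightarrow> real) \<Rightarrow> bool" where
  "subsolution F f \<longleftrightarrow> (\<forall>x\<in>verts G. F x (f x) \<le> laplacian G f x)"

lemma subsolution_max:
  assumes "subsolution F f" "subsolution F f'"
  shows "subsolution F (\<lambda>x. max (f x) (f' x))"
  unfolding subsolution_def
proof
  fix x assume x: "x \<in> verts G"
  show "F x (max (f x) (f' x)) \<le> laplacian G (\<lambda>x. max (f x) (f' x)) x"
  proof (cases "f x \<le> f' x")
    case True
    then show ?thesis
      using assms(2) x laplacian_mono[of x f' "\<lambda>x. max (f x) (f' x)"]
      by (force simp: subsolution_def max_def)
  next
    case False
    then show ?thesis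
      using assms(1) x laplacian_mono[of x f "\<lambda>x. max (f x) (f' x)"]
      by (force simp: subsolution_def max_def)
  qed
qed

lemma subsolution_raise:
  assumes "subsolution F f" "f x \<le> t" "F x t \<le> laplacian G (f(x := t)) x"
  shows "subsolution F (f(x := t))"
  unfolding subsolution_def
proof
  fix z assume z: "z \<in> verts G"
  show "F z ((f(x := t)) z) \<le> laplacian G (f(x := t)) z"
  proof (cases "z = x")
    case False
    then have "laplacian G f z \<le> laplacian G (f(x := t)) z"
      using z assms(2) by (intro laplacian_mono) auto
    then show ?thesis
      using assms(1) z False by (force simp: subsolution_def)
  qed (use assms(3) in simp)
qed

section \<open>Perron's method\<close>

text \<open>
  Closure under maxima makes the family directed, so finitely many values of the supremum are
  approximated by a single member.
\<close>

lemma directed_approx_Sup: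
  fixes K :: "('a \<Rightarrow> real) set"
  assumes "finite N" "K \<noteq> {}" "e > 0"
    and bdd: "\<And>y. y \<in> N \<Longrightarrow> bdd_above ((\<lambda>f. f y) ` K)"
    and max: "\<And>f f'. f \<in> K \<Longrightarrow> f' \<in> K \<Longrightarrow> (\<lambda>y. max (f y) (f' y)) \<in> K"
  shows "\<exists>f\<in>K. \<forall>y\<in>N. (SUP f\<in>K. f y) - e < f y"
  using \<open>finite N\<close> bdd
proof (induction N)
  case empty
  then show ?case using \<open>K \<noteq> {}\<close> by auto
next
  case (insert z N)
  then obtain f where f: "f \<in> K" "\<forall>y\<in>N. (SUP f\<in>K. f y) - e < f y"
    by auto
  have "(SUP f\<in>K. f z) - e < (SUP f\<in>K. f z)"
    using \<open>e > 0\<close> by simp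
  then obtain f' where f': "f' \<in> K" "(SUP f\<in>K. f z) - e < f' z"
    using less_cSUP_iff[OF \<open>K \<noteq> {}\<close> insert.prems[of z]] by auto
  show ?case
    by (rule bexI[OF _ max[OF f(1) f'(1)]]) (use f(2) f'(2) in \<open>auto simp: less_max_iff_disj\<close>)
qed

text \<open>
  The supremum \<open>u\<close> is a subsolution because raising the neighbours to \<open>u\<close> only helps and the
  resulting inequality at \<open>x\<close> is a closed condition on the value at \<open>x\<close>.  If the
  inequality were strict at \<open>x\<close>, it would survive with a value \<open>t > u x\<close> at \<open>x\<close>,
  and then also for some member of the family that is close enough to \<open>u\<close> at the neighbours;
  raising this member to \<open>t\<close> contradicts the definition of \<open>u\<close>.
\<close>

lemma perron_solution:
  fixes F :: "'a \<Rightarrow> real \<Rightarrow> real" and K :: "('a \<Rightarrow> real) set"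
  defines "u \<equiv> \<lambda>x. SUP f\<in>K. f x"
  assumes cont: "\<And>x. x \<in> verts G \<Longrightarrow> continuous_on UNIV (F x)"
    and ne: "K \<noteq> {}"
    and sub: "\<And>f. f \<in> K \<Longrightarrow> subsolution F f"
    and bdd: "\<And>x. x \<in> verts G \<Longrightarrow> bdd_above ((\<lambda>f. f x) ` K)"
    and max: "\<And>f f'. f \<in> K \<Longrightarrow> f' \<in> K \<Longrightarrow> (\<lambda>y. max (f y) (f' y)) \<in> K"
    and raise: "\<And>f x t. f \<in> K \<Longrightarrow> x \<in> verts G \<Longrightarrow> f x \<le> t \<Longrightarrow>
      F x t \<le> laplacian G (f(x := t)) x \<Longrightarrow> f(x := t) \<in> K"
    and x: "x \<in> verts G"
  shows "laplacian G u x = F x (u x)"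
proof (rule antisym)
  have le_u: "f y \<le> u y" if "f \<in> K" "y \<in> verts G" for f y
    unfolding u_def by (rule cSUP_upper[OF that(1) bdd[OF that(2)]])
  define P where "P t = laplacian G (u(x := t)) x" for t
  have P: "P t = 1 / vmeas G x * (\<Sum>y\<in>nbrs G x. emeas G x y * (u y - t))" for t
    unfolding P_def by (rule laplacian_fun_upd)
  have P_u: "P (u x) = laplacian G u x"
    by (simp add: P_def)
  have contP: "continuous_on UNIV (\<lambda>t. P t - F x t)"
    unfolding P by (intro continuous_intros cont x)
  show "F x (u x) \<le> laplacian G u x"
  proof -
    define T where "T = {t. 0 \<le> P t - F x t}"
    have "closed T"
      unfolding T_def by (rule closed_Collect_le[OF continuous_on_const contP])
    moreover have "(\<lambda>f. f x) ` K \<subseteq> T"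
    proof clarsimp
      fix f assume f: "f \<in> K"
      have "laplacian G f x \<le> P (f x)"
        unfolding P_def using f by (intro laplacian_mono x) (auto simp: le_u)
      then show "f x \<in> T"
        using sub[OF f] x by (force simp: T_def subsolution_def)
    qed
    ultimately have "u x \<in> T"
      unfolding u_def using ne bdd[OF x] closed_subset_contains_Sup by blast
    then show ?thesis
      by (simp add: T_def P_u)
  qed
  show "laplacian G u x \<le> F x (u x)"
  proof (rule ccontr)
    assume "\<not> laplacian G u x \<le> F x (u x)"
    then have pos: "0 < P (u x) - F x (u x)"
      by (simp add: P_u)
    have "open {t. 0 < P t - F x t}"
      by (rule open_Collect_less[OF continuous_on_const contP])
    then obtain d where d: "d > 0" "\<And>t. dist t (u x) < d \<Longrightarrow> 0 < P t - F x t"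
      using pos unfolding open_dist by blast
    define t where "t = u x + d / 2"
    have t: "u x < t" "0 < P t - F x t"
      using d by (auto simp: t_def dist_real_def)
    define D where "D = 1 / vmeas G x * (\<Sum>y\<in>nbrs G x. emeas G x y)"
    have D: "D \<ge> 0"
      unfolding D_def using vmeas_pos[OF x] emeas_pos[of _ x]
      by (intro mult_nonneg_nonneg sum_nonneg) (auto intro: less_imp_le)
    define e where "e = (P t - F x t) / (D + 1)"
    have e: "e > 0" "e * D \<le> P t - F x t"
      using t D by (auto simp: e_def field_simps)
    have "\<exists>f\<in>K. \<forall>y\<in>nbrs G x. u y - e < f y"
      unfolding u_def
    proof (rule directed_approx_Sup[OF finite_nbrs[OF x] ne e(1) _ max])
      show "bdd_above ((\<lambda>f. f y) ` K)" if "y \<in> nbrs G x" for y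
        by (rule bdd[OF nbrs_verts[OF that]])
    qed
    then obtain f where f: "f \<in> K" "\<forall>y\<in>nbrs G x. u y - e < f y"
      by blast
    have "P t - e * D = 1 / vmeas G x * (\<Sum>y\<in>nbrs G x. emeas G x y * (u y - e - t))"
      unfolding P D_def
      by (simp add: algebra_simps sum.distrib sum_subtractf sum_distrib_left sum_distrib_right)
    also have "\<dots> \<le> laplacian G (f(x := t)) x"
      unfolding laplacian_fun_upd using vmeas_pos[OF x] emeas_pos[of _ x] f(2)
      by (intro mult_left_mono sum_mono) (auto intro: less_imp_le)
    finally have "F x t \<le> laplacian G (f(x := t)) x"
      using e by linarith
    then have "f(x := t) \<in> K"
      using f(1) x t(1) le_u[OF f(1) x] by (intro raise) auto
    from le_u[OF this x] t(1) show False
      by simp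
  qed
qed

definition finite_subsolutions :: "('a \<Rightarrow> real \<Rightarrow> real) \<Rightarrow> ('a \<Rightarrow> real) set" where
  "finite_subsolutions F =
     {f. subsolution F f \<and> (\<forall>x. 0 \<le> f x) \<and> finite {x. f x \<noteq> 0} \<and> {x. f x \<noteq> 0} \<subseteq> verts G}"

text \<open>
  Finite support makes the energy estimates below finite sums, and it survives both maxima and raising
  at a single vertex.  Hence these estimates, once they bound the family pointwise, already give a
  solution on the whole graph; zero makes the family nonempty.
\<close>

lemma solution_from_finite_subsolutions:
  fixes F :: "'a \<Rightarrow> real \<Rightarrow> real"
  assumes cont: "\<And>x. x \<in> verts G \<Longrightarrow> continuous_on UNIV (F x)"
    and zero: "\<And>x. x \<in> verts G \<Longrightarrow> F x 0 \<le> 0"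
    and bound: "\<And>x. x \<in> verts G \<Longrightarrow> \<exists>B. \<forall>f\<in>finite_subsolutions F. f x \<le> B"
  shows "\<exists>u. \<forall>x\<in>verts G. 0 \<le> u x \<and> laplacian G u x = F x (u x)"
proof -
  define K where "K = finite_subsolutions F"
  define u where "u = (\<lambda>x. SUP f\<in>K. f x)"
  have zero_in: "(\<lambda>x. 0) \<in> K"
    using zero by (auto simp: K_def finite_subsolutions_def subsolution_def laplacian_def)
  have bdd: "bdd_above ((\<lambda>f. f x) ` K)" if "x \<in> verts G" for x
    using bound[OF that] by (auto simp: K_def bdd_above_def)
  have max: "(\<lambda>y. max (f y) (f' y)) \<in> K" if "f \<in> K" "f' \<in> K" for f f'
  proof -
    have "{y. max (f y) (f' y) \<noteq> 0} \<subseteq> {y. f y \<noteq> 0} \<union> {y. f' y \<noteq> 0}"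
      by (auto simp: max_def)
    then show ?thesis
      using that
      unfolding K_def finite_subsolutions_def
      by (auto simp: subsolution_max intro: finite_subset le_max_iff_disj[THEN iffD2])
  qed
  have raise: "f(x := t) \<in> K"
    if "f \<in> K" "x \<in> verts G" "f x \<le> t" "F x t \<le> laplacian G (f(x := t)) x" for f x t
  proof -
    have supp: "{y. (f(x := t)) y \<noteq> 0} \<subseteq> insert x {y. f y \<noteq> 0}"
      by auto
    have "finite {y. (f(x := t)) y \<noteq> 0}"
      using that(1) by (intro finite_subset[OF supp]) (simp add: K_def finite_subsolutions_def)
    moreover have "{y. (f(x := t)) y \<noteq> 0} \<subseteq> verts G"
      using that(1,2) supp by (auto simp: K_def finite_subsolutions_def)
    moreover have "\<forall>y. 0 \<le> (f(x := t)) y"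
      using that(1,3) by (auto simp: K_def finite_subsolutions_def intro: order_trans)
    moreover have "subsolution F (f(x := t))"
      using that by (intro subsolution_raise) (auto simp: K_def finite_subsolutions_def)
    ultimately show ?thesis
      by (simp add: K_def finite_subsolutions_def)
  qed
  have "0 \<le> u x \<and> laplacian G u x = F x (u x)" if x: "x \<in> verts G" for x
  proof
    show "0 \<le> u x"
      unfolding u_def using cSUP_upper[OF zero_in bdd[OF x]] by simp
    show "laplacian G u x = F x (u x)"
      unfolding u_def
    proof (rule perron_solution[OF cont _ _ bdd max raise x])
      show "K \<noteq> {}" using zero_in by blast
    qed (auto simp: K_def finite_subsolutions_def)
  qed
  then show ?thesis by blast
qed

text \<open>
  Raising a value cannot lead above the supersolution \<open>u\<close>: the neighbours lie below \<open>u\<close>, and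
  the value at \<open>x\<close> compatible with given neighbours is limited monotonically because
  \<open>t \<mapsto> deg(x) t + \<mu>(x) F(x, t)\<close> is strictly increasing.  This is where every vertex must
  have a neighbour.
\<close>

lemma solution_between:
  fixes F :: "'a \<Rightarrow> real \<Rightarrow> real"
  assumes cont: "\<And>x. x \<in> verts G \<Longrightarrow> continuous_on UNIV (F x)"
    and mono: "\<And>x. x \<in> verts G \<Longrightarrow> mono (F x)"
    and nbrs: "\<And>x. x \<in> verts G \<Longrightarrow> nbrs G x \<noteq> {}"
    and sub: "subsolution F v"
    and super: "\<And>x. x \<in> verts G \<Longrightarrow> laplacian G u x \<le> F x (u x)"
    and le: "\<And>x. x \<in> verts G \<Longrightarrow> v x \<le> u x"
  shows "\<exists>f. \<forall>x\<in>verts G. laplacian G f x = F x (f x)"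
proof -
  define K where "K = {f. subsolution F f \<and> (\<forall>x\<in>verts G. f x \<le> u x)}"
  have raise: "f(x := t) \<in> K"
    if f: "f \<in> K" and x: "x \<in> verts G" and t: "f x \<le> t" "F x t \<le> laplacian G (f(x := t)) x"
    for f x t
  proof -
    have "t \<le> u x"
    proof (rule ccontr)
      assume "\<not> t \<le> u x"
      then have less: "u x < t" by simp
      have "laplacian G (f(x := t)) x < laplacian G u x"
        unfolding laplacian_fun_upd unfolding laplacian_def
      proof (intro mult_strict_left_mono sum_strict_mono)
        fix y assume y: "y \<in> nbrs G x"
        then have "f y \<le> u y"
          using f nbrs_verts by (auto simp: K_def)
        then show "f y - t < u y - u x"
          using less by linarith
      qed (use vmeas_pos[OF x] finite_nbrs[OF x] nbrs[OF x] emeas_pos in auto)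
      also have "\<dots> \<le> F x t"
        using super[OF x] monoD[OF mono[OF x] less_imp_le[OF less]] by linarith
      finally show False
        using t(2) by simp
    qed
    then show ?thesis
      using that subsolution_raise[of F f x t] by (auto simp: K_def)
  qed
  have "\<forall>x\<in>verts G. laplacian G (\<lambda>x. SUP f\<in>K. f x) x = F x (SUP f\<in>K. f x)"
  proof
    fix x assume x: "x \<in> verts G"
    show "laplacian G (\<lambda>x. SUP f\<in>K. f x) x = F x (SUP f\<in>K. f x)"
    proof (rule perron_solution[OF cont _ _ _ _ raise x])
      show "K \<noteq> {}"
        using sub le by (auto simp: K_def)
    qed (auto simp: K_def subsolution_max intro!: bdd_aboveI2)
  qed
  then show ?thesis by blast
qed

section \<open>Summation by parts\<close>

lemma vclosure_altdef: "vclosure G W = W \<union> (\<Union>x\<in>W. nbrs G x)"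
proof -
  have "x \<in> verts G \<and> (x, y) \<in> edges G \<longleftrightarrow> x \<in> nbrs G y" for x y
    using edge_sym[of x y] nbrs_verts[of x y] by (auto simp: nbrs_def)
  then show ?thesis
    unfolding vclosure_def by blast
qed

lemma finite_vclosure: "finite W \<Longrightarrow> W \<subseteq> verts G \<Longrightarrow> finite (vclosure G W)"
  unfolding vclosure_altdef using finite_nbrs by auto

definition dirichlet_form :: "'a set \<Rightarrow> ('a \<Rightarrow> real) \<Rightarrow> ('a \<Rightarrow> real) \<Rightarrow> real" where
  "dirichlet_form B f p =
     1 / 2 * (\<Sum>x\<in>B. \<Sum>y\<in>nbrs G x \<inter> B. emeas G x y * ((f x - f y) * (p x - p y)))"

text \<open>
  The closure of \<open>A\<close> contains every neighbour of \<open>A\<close>, and \<open>p\<close> vanishes off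
  \<open>A\<close>, so the left-hand side is a double sum over ordered edges inside the closure; averaging it with
  its transpose gives the form.
\<close>

lemma green_identity:
  assumes fin: "finite A" and A: "A \<subseteq> verts G" and supp: "\<And>x. x \<notin> A \<Longrightarrow> p x = 0"
  shows "(\<Sum>x\<in>A. p x * laplacian G f x * vmeas G x) = - dirichlet_form (vclosure G A) f p"
proof -
  let ?B = "vclosure G A"
  define T where "T q = (\<Sum>x\<in>?B. \<Sum>y\<in>nbrs G x \<inter> ?B. emeas G x y * q x y)"
    for q :: "'a \<Rightarrow> 'a \<Rightarrow> real"
  have finB: "finite ?B"
    using finite_vclosure fin A .
  have swap: "T q = T (\<lambda>x y. q y x)" for q
  proof -
    have inter: "nbrs G x \<inter> ?B = {y. y \<in> ?B \<and> (x, y) \<in> edges G}" for x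
      by (auto simp: nbrs_def)
    have "T q = (\<Sum>y\<in>?B. \<Sum>x | x \<in> ?B \<and> (x, y) \<in> edges G. emeas G x y * q x y)"
      unfolding T_def inter by (rule sum.swap_restrict[OF finB finB])
    also have "\<dots> = T (\<lambda>x y. q y x)"
      unfolding T_def inter
    proof (intro sum.cong refl)
      fix x y assume "x \<in> {x. x \<in> ?B \<and> (y, x) \<in> edges G}"
      then show "emeas G x y * q x y = emeas G y x * q x y"
        using emeas_sym[of x y] by (simp add: nbrs_def)
    qed (use edge_sym in auto)
    finally show ?thesis .
  qed
  have "(\<Sum>x\<in>A. p x * laplacian G f x * vmeas G x) =
      (\<Sum>x\<in>A. \<Sum>y\<in>nbrs G x \<inter> ?B. emeas G x y * (p x * (f y - f x)))"
  proof (rule sum.cong[OF refl])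
    fix x assume x: "x \<in> A"
    have "nbrs G x \<inter> ?B = nbrs G x"
      using x A by (auto simp: vclosure_altdef)
    then show "p x * laplacian G f x * vmeas G x =
        (\<Sum>y\<in>nbrs G x \<inter> ?B. emeas G x y * (p x * (f y - f x)))"
      using x A vmeas_pos[of x]
      by (auto simp: laplacian_def sum_distrib_left mult_ac intro!: sum.cong)
  qed
  also have "\<dots> = T (\<lambda>x y. p x * (f y - f x))"
    unfolding T_def
    by (rule sum.mono_neutral_left[OF finB]) (auto simp: vclosure_def supp)
  finally have lhs: "(\<Sum>x\<in>A. p x * laplacian G f x * vmeas G x) = T (\<lambda>x y. p x * (f y - f x))" .
  have "2 * T (\<lambda>x y. p x * (f y - f x)) = T (\<lambda>x y. p x * (f y - f x)) + T (\<lambda>x y. p y * (f x - f y))"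
    using swap[of "\<lambda>x y. p x * (f y - f x)"] by simp
  also have "\<dots> = - 2 * dirichlet_form ?B f p"
    unfolding T_def dirichlet_form_def
    by (simp add: sum.distrib[symmetric] sum_negf[symmetric] algebra_simps)
  finally show ?thesis by (simp add: lhs)
qed

lemma dirichlet_form_mono:
  assumes "\<And>x y. (f x - f y) * (p x - p y) \<le> (f' x - f' y) * (p' x - p' y)"
  shows "dirichlet_form B f p \<le> dirichlet_form B f' p'"
  unfolding dirichlet_form_def using assms emeas_pos
  by (intro mult_left_mono sum_mono) (auto intro: less_imp_le)

text \<open>
  The inequality for a subsolution, integrated against \<open>p \<ge> 0\<close>: the energy pairing of \<open>f\<close>
  with its test function is controlled by the right-hand side of the equation.
\<close>

lemma subsolution_energy:
  assumes "subsolution F f" "finite A" "A \<subseteq> verts G"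
    and "\<And>x. x \<notin> A \<Longrightarrow> p x = 0" "\<And>x. 0 \<le> p x"
  shows "dirichlet_form (vclosure G A) f p \<le> (\<Sum>x\<in>A. - F x (f x) * p x * vmeas G x)"
proof -
  have "(\<Sum>x\<in>A. F x (f x) * p x * vmeas G x) \<le> (\<Sum>x\<in>A. p x * laplacian G f x * vmeas G x)"
  proof (rule sum_mono)
    fix x assume "x \<in> A"
    then have x: "x \<in> verts G" using assms(3) by blast
    have "F x (f x) * p x \<le> laplacian G f x * p x"
      using assms(1,5) x by (intro mult_right_mono) (auto simp: subsolution_def)
    then show "F x (f x) * p x * vmeas G x \<le> p x * laplacian G f x * vmeas G x"
      using vmeas_pos[OF x] by (simp add: mult.commute)
  qed
  then show ?thesis
    by (simp add: green_identity assms sum_negf)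
qed

section \<open>Pointwise bounds for finitely supported subsolutions\<close>

text \<open>
  The test function \<open>p\<close> increases with \<open>f\<close>, so the energy pairing is nonnegative and
  drops out: what remains is a comparison of the two zero-order terms.
\<close>

lemma exp_subsolution_bound:
  assumes h: "\<And>x. x \<in> verts G \<Longrightarrow> h x < 0"
    and int: "vintegrable G (\<lambda>x. (g x / h x)\<^sup>2 * \<bar>h x\<bar>)"
    and f: "f \<in> finite_subsolutions (\<lambda>x t. g x - h x * exp t)"
    and x: "x \<in> verts G"
  shows "f x \<le> 1 + vintegral G (\<lambda>x. (g x / h x)\<^sup>2 * \<bar>h x\<bar>) / (\<bar>h x\<bar> * vmeas G x)"
proof -
  define I where "I = vintegral G (\<lambda>x. (g x / h x)\<^sup>2 * \<bar>h x\<bar>)"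
  define A where "A = insert x {x. f x \<noteq> 0}"
  define p where "p x = exp (f x) - 1" for x
  have A: "finite A" "A \<subseteq> verts G" "x \<in> A"
    using f x by (auto simp: A_def finite_subsolutions_def)
  have f0: "0 \<le> f y" for y
    using f by (simp add: finite_subsolutions_def)
  have f_le_p: "f y \<le> p y" for y
    unfolding p_def using exp_ge_add_one_self[of "f y"] by linarith
  have p0: "0 \<le> p y" for y
    using f0[of y] f_le_p[of y] by linarith
  have "0 = dirichlet_form (vclosure G A) (\<lambda>_. 0) p"
    by (simp add: dirichlet_form_def)
  also have "\<dots> \<le> dirichlet_form (vclosure G A) f p"
  proof (rule dirichlet_form_mono)
    show "(0 - 0) * (p x - p y) \<le> (f x - f y) * (p x - p y)" for x y
      by (cases "f x \<le> f y") (auto simp: p_def mult_nonpos_nonpos)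
  qed
  also have "\<dots> \<le> (\<Sum>y\<in>A. - (g y - h y * exp (f y)) * p y * vmeas G y)"
    by (rule subsolution_energy[where F = "\<lambda>x t. g x - h x * exp t"])
      (use f A p0 in \<open>auto simp: finite_subsolutions_def A_def p_def\<close>)
  also have "\<dots> \<le> (\<Sum>y\<in>A. 1 / 2 * ((g y / h y)\<^sup>2 * \<bar>h y\<bar> * vmeas G y - \<bar>h y\<bar> * (p y)\<^sup>2 * vmeas G y))"
  proof (rule sum_mono)
    fix y assume "y \<in> A"
    then have y: "y \<in> verts G" using A by blast
    define q where "q = g y / h y"
    have q: "g y = q * h y" and hy: "h y < 0"
      using h[OF y] by (auto simp: q_def)
    \<comment> \<open>Young's inequality \<open>q p \<le> (q\<^sup>2 + p\<^sup>2) / 2\<close> together with \<open>e\<^sup>f = p + 1 \<ge> p\<close>.\<close>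
    have "exp (f y) = p y + 1"
      by (simp add: p_def)
    then have "(q - exp (f y)) * p y = 1 / 2 * (q\<^sup>2 - (p y)\<^sup>2) - 1 / 2 * (q - p y)\<^sup>2 - p y"
      by (simp add: power2_eq_square algebra_simps)
    then have "(q - exp (f y)) * p y \<le> 1 / 2 * (q\<^sup>2 - (p y)\<^sup>2)"
      using p0[of y] zero_le_power2[of "q - p y"] by linarith
    then have "\<bar>h y\<bar> * vmeas G y * ((q - exp (f y)) * p y) \<le> \<bar>h y\<bar> * vmeas G y * (1 / 2 * (q\<^sup>2 - (p y)\<^sup>2))"
      using vmeas_pos[OF y] by (intro mult_left_mono) auto
    then show "- (g y - h y * exp (f y)) * p y * vmeas G y \<le>
        1 / 2 * ((g y / h y)\<^sup>2 * \<bar>h y\<bar> * vmeas G y - \<bar>h y\<bar> * (p y)\<^sup>2 * vmeas G y)"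
      unfolding q_def[symmetric] using hy by (simp add: q algebra_simps)
  qed
  finally have "(\<Sum>y\<in>A. \<bar>h y\<bar> * (p y)\<^sup>2 * vmeas G y) \<le> (\<Sum>y\<in>A. (g y / h y)\<^sup>2 * \<bar>h y\<bar> * vmeas G y)"
    unfolding sum_distrib_left[symmetric] sum_subtractf by simp
  also have "\<dots> \<le> I"
    unfolding I_def vintegral_def
    using int A vmeas_pos by (intro finite_sum_le_infsum) (auto simp: vintegrable_def less_imp_le)
  finally have "(\<Sum>y\<in>A. \<bar>h y\<bar> * (p y)\<^sup>2 * vmeas G y) \<le> I" .
  moreover have "\<bar>h x\<bar> * (p x)\<^sup>2 * vmeas G x \<le> (\<Sum>y\<in>A. \<bar>h y\<bar> * (p y)\<^sup>2 * vmeas G y)"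
    using A vmeas_pos by (intro member_le_sum) (auto simp: less_imp_le subset_iff)
  ultimately have "(p x)\<^sup>2 * (\<bar>h x\<bar> * vmeas G x) \<le> I"
    by (simp only: mult_ac)
  moreover have "0 < \<bar>h x\<bar> * vmeas G x"
    using h[OF x] vmeas_pos[OF x] by (intro mult_pos_pos) auto
  ultimately have "(p x)\<^sup>2 \<le> I / (\<bar>h x\<bar> * vmeas G x)"
    by (simp only: pos_le_divide_eq)
  moreover have "p x \<le> 1 + (p x)\<^sup>2"
  proof -
    have "(p x - 1)\<^sup>2 \<ge> 0" by simp
    then show ?thesis
      using p0[of x] by (simp add: power2_eq_square algebra_simps)
  qed
  ultimately show ?thesis
    using f_le_p[of x] by (simp add: I_def)
qed

lemma Lp_norm_2_full_subgraph:
  assumes "finite B" "B \<subseteq> verts G"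
  shows "Lp_norm 2 (full_subgraph G B) f = sqrt (\<Sum>x\<in>B. (f x)\<^sup>2 * vmeas G x)"
proof -
  have "0 \<le> (\<Sum>x\<in>B. (f x)\<^sup>2 * vmeas G x)"
    using assms vmeas_pos by (intro sum_nonneg) (auto simp: less_imp_le subset_iff)
  then show ?thesis
    using assms by (simp add: Lp_norm_def vintegral_def full_subgraph_def powr_half_sqrt)
qed

lemma grad_modulus_energy:
  assumes "finite B" "B \<subseteq> verts G"
  shows "(\<Sum>x\<in>B. (grad_modulus (full_subgraph G B) f x)\<^sup>2 * vmeas G x) = dirichlet_form B f f"
proof -
  have "(grad_modulus (full_subgraph G B) f x)\<^sup>2 * vmeas G x =
      1 / 2 * (\<Sum>y\<in>nbrs G x \<inter> B. emeas G x y * ((f x - f y) * (f x - f y)))" if x: "x \<in> B" for x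
  proof -
    have n: "nbrs (full_subgraph G B) x = nbrs G x \<inter> B"
      using x by (auto simp: nbrs_def full_subgraph_def)
    have "0 \<le> (\<Sum>y\<in>nbrs G x \<inter> B. emeas G x y * (f x - f y)\<^sup>2)"
      using emeas_pos by (intro sum_nonneg) (auto simp: less_imp_le)
    moreover have "vmeas G x > 0"
      using x assms vmeas_pos by blast
    ultimately show ?thesis
      unfolding grad_modulus_def n
      by (simp add: full_subgraph_def power2_eq_square[symmetric])
  qed
  then show ?thesis
    by (simp add: dirichlet_form_def sum_distrib_left)
qed

lemma exhaustion_finite_subset:
  assumes "exhaustion G W" "finite A" "A \<subseteq> verts G"
  shows "\<exists>k. A \<subseteq> W k"
using assms(2,3)
proof (induction A)
  case (insert a A)
  then obtain k j where "A \<subseteq> W k" "a \<in> W j"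
    using assms(1) by (auto simp: exhaustion_def)
  moreover have "incseq W"
    using assms(1) by (intro incseq_SucI) (auto simp: exhaustion_def)
  ultimately have "insert a A \<subseteq> W (max k j)"
    by (meson incseqD insert_subset max.cobounded1 max.cobounded2 order_trans subsetD)
  then show ?case by blast
qed simp

text \<open>The Cheeger inequality in squared form; it is no longer strict, so that \<open>m = 0\<close> is covered too.\<close>

lemma cheeger_energy:
  assumes A: "finite A" "A \<subseteq> verts G" and C: "C > 0"
    and cheeger: "\<And>m. \<exists>x\<in>vclosure G A. m x \<noteq> 0 \<Longrightarrow> \<forall>x\<in>vboundary G A. m x = 0 \<Longrightarrow>
      (let H = full_subgraph G (vclosure G A)
       in Lp_norm 2 H (grad_modulus H m) > C * Lp_norm 2 H m)"
    and supp: "\<And>x. x \<notin> A \<Longrightarrow> m x = 0"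
  shows "C\<^sup>2 * (\<Sum>x\<in>A. (m x)\<^sup>2 * vmeas G x) \<le> dirichlet_form (vclosure G A) m m"
proof (cases "\<exists>x\<in>vclosure G A. m x \<noteq> 0")
  case True
  let ?B = "vclosure G A"
  have B: "finite ?B" "?B \<subseteq> verts G"
    using finite_vclosure[OF A] A by (auto simp: vclosure_def)
  have "(\<Sum>x\<in>A. (m x)\<^sup>2 * vmeas G x) = (\<Sum>x\<in>?B. (m x)\<^sup>2 * vmeas G x)"
    by (rule sum.mono_neutral_left[OF B(1)]) (auto simp: vclosure_def supp)
  moreover have "C * sqrt (\<Sum>x\<in>?B. (m x)\<^sup>2 * vmeas G x) < sqrt (dirichlet_form ?B m m)"
    using cheeger[OF True] supp
    by (simp add: vboundary_def Let_def Lp_norm_2_full_subgraph[OF B] grad_modulus_energy[OF B])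
  then have "sqrt (C\<^sup>2 * (\<Sum>x\<in>?B. (m x)\<^sup>2 * vmeas G x)) < sqrt (dirichlet_form ?B m m)"
    using C by (simp add: real_sqrt_mult)
  ultimately show ?thesis by simp
next
  case False
  then have "m x = 0" if "x \<in> A" for x
    using that by (auto simp: vclosure_def)
  then have "(\<Sum>x\<in>A. (m x)\<^sup>2 * vmeas G x) = 0"
    by simp
  moreover have "dirichlet_form (vclosure G A) (\<lambda>_. 0) m \<le> dirichlet_form (vclosure G A) m m"
    by (rule dirichlet_form_mono) simp
  ultimately show ?thesis
    by (simp add: dirichlet_form_def)
qed

text \<open>
  Truncating at the very height \<open>t = f x\<close> makes both sides explicit in \<open>t\<close>: the estimate
  \<open>C\<^sup>2 \<mu>(x) t\<^sup>2 \<le> \<parallel>g\<parallel>\<^sup>2 / C\<^sup>2 + 2 t \<parallel>h\<parallel>\<^sub>1\<close> bounds \<open>t\<close>,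
  whereas the test function \<open>f\<close> itself would require \<open>h\<close> to be square integrable.
\<close>

lemma poisson_subsolution_bound:
  assumes W: "exhaustion G W" and C: "C > 0"
    and cheeger: "\<And>k m. \<exists>x\<in>vclosure G (W k). m x \<noteq> 0 \<Longrightarrow> \<forall>x\<in>vboundary G (W k). m x = 0 \<Longrightarrow>
      (let H = full_subgraph G (vclosure G (W k))
       in Lp_norm 2 H (grad_modulus H m) > C * Lp_norm 2 H m)"
    and g: "vintegrable G (\<lambda>x. (g x)\<^sup>2)" and h: "vintegrable G (\<lambda>x. \<bar>h x\<bar>)"
    and f: "f \<in> finite_subsolutions (\<lambda>x t. - (\<bar>g x\<bar> + \<bar>h x\<bar>))"
    and x: "x \<in> verts G"
  shows "f x \<le> 1 + (vintegral G (\<lambda>x. (g x)\<^sup>2) / C\<^sup>2 + 2 * vintegral G (\<lambda>x. \<bar>h x\<bar>)) /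
    (C\<^sup>2 * vmeas G x)"
proof -
  define I where "I = vintegral G (\<lambda>x. (g x)\<^sup>2)"
  define J where "J = vintegral G (\<lambda>x. \<bar>h x\<bar>)"
  define t where "t = f x"
  define m where "m y = min (f y) t" for y
  have f0: "0 \<le> f y" for y
    using f by (simp add: finite_subsolutions_def)
  then have t0: "0 \<le> t" and m0: "0 \<le> m y" and mt: "m y \<le> t" for y
    by (auto simp: t_def m_def)
  have mx: "m x = t"
    by (simp add: m_def t_def)
  obtain k where k: "insert x {x. f x \<noteq> 0} \<subseteq> W k"
    using exhaustion_finite_subset[OF W, of "insert x {x. f x \<noteq> 0}"] f x
    by (auto simp: finite_subsolutions_def)
  define A where "A = W k"
  have A: "finite A" "A \<subseteq> verts G" "x \<in> A"
    using W k by (auto simp: A_def exhaustion_def)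
  have supp: "m y = 0" if "y \<notin> A" for y
  proof -
    have "f y = 0" using that k by (auto simp: A_def)
    then show ?thesis using t0 by (simp add: m_def)
  qed
  define N where "N = (\<Sum>y\<in>A. (m y)\<^sup>2 * vmeas G y)"
  have \<mu>: "0 \<le> vmeas G y" if "y \<in> verts G" for y
    using vmeas_pos[OF that] by simp
  have gI: "(\<Sum>y\<in>A. (g y)\<^sup>2 * vmeas G y) \<le> I"
    unfolding I_def vintegral_def
    using g A \<mu> by (intro finite_sum_le_infsum) (auto simp: vintegrable_def)
  have hJ: "(\<Sum>y\<in>A. \<bar>h y\<bar> * vmeas G y) \<le> J"
    unfolding J_def vintegral_def
    using h A \<mu> by (intro finite_sum_le_infsum) (auto simp: vintegrable_def)
  have I0: "0 \<le> I" and J0: "0 \<le> J"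
    unfolding I_def J_def vintegral_def using \<mu> by (auto intro!: infsum_nonneg)
  have "C\<^sup>2 * N \<le> dirichlet_form (vclosure G A) m m"
    unfolding N_def using cheeger_energy[OF A(1,2) C _ supp] cheeger by (simp add: A_def)
  also have "\<dots> \<le> dirichlet_form (vclosure G A) f m"
  proof (rule dirichlet_form_mono)
    \<comment> \<open>Truncation is nondecreasing and 1-Lipschitz.\<close>
    show "(m y - m z) * (m y - m z) \<le> (f y - f z) * (m y - m z)" for y z
    proof -
      have "0 \<le> m y - m z \<and> m y - m z \<le> f y - f z \<or> m y - m z \<le> 0 \<and> f y - f z \<le> m y - m z"
        by (auto simp: m_def)
      then show ?thesis
        by (auto intro: mult_right_mono mult_right_mono_neg)
    qed
  qed
  also have "\<dots> \<le> (\<Sum>y\<in>A. - (- (\<bar>g y\<bar> + \<bar>h y\<bar>)) * m y * vmeas G y)"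
    by (rule subsolution_energy[where F = "\<lambda>x t. - (\<bar>g x\<bar> + \<bar>h x\<bar>)"])
      (use f A supp m0 in \<open>auto simp: finite_subsolutions_def\<close>)
  also have "\<dots> \<le> (\<Sum>y\<in>A. 1 / (2 * C\<^sup>2) * ((g y)\<^sup>2 * vmeas G y) +
      C\<^sup>2 / 2 * ((m y)\<^sup>2 * vmeas G y) + t * (\<bar>h y\<bar> * vmeas G y))"
  proof (rule sum_mono)
    fix y assume "y \<in> A"
    then have y: "y \<in> verts G" using A by blast
    \<comment> \<open>Young's inequality, weighted so that half of the left-hand side \<open>C\<^sup>2 N\<close> absorbs the
      quadratic term.\<close>
    have "0 \<le> (\<bar>g y\<bar> / C - C * m y)\<^sup>2"
      by simp
    then have "2 * (\<bar>g y\<bar> * m y) \<le> (g y)\<^sup>2 / C\<^sup>2 + C\<^sup>2 * (m y)\<^sup>2"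
      using C by (simp add: power2_diff power_divide power_mult_distrib)
    then have "\<bar>g y\<bar> * m y \<le> 1 / (2 * C\<^sup>2) * (g y)\<^sup>2 + C\<^sup>2 / 2 * (m y)\<^sup>2"
      by (simp add: field_simps)
    moreover have "\<bar>h y\<bar> * m y \<le> t * \<bar>h y\<bar>"
      using mt[of y] mult_left_mono[of "m y" t "\<bar>h y\<bar>"] by (simp add: mult.commute)
    ultimately have "(\<bar>g y\<bar> + \<bar>h y\<bar>) * m y \<le>
        1 / (2 * C\<^sup>2) * (g y)\<^sup>2 + C\<^sup>2 / 2 * (m y)\<^sup>2 + t * \<bar>h y\<bar>"
      by (simp add: distrib_right)
    from mult_right_mono[OF this \<mu>[OF y]]
    show "- (- (\<bar>g y\<bar> + \<bar>h y\<bar>)) * m y * vmeas G y \<le> 1 / (2 * C\<^sup>2) * ((g y)\<^sup>2 * vmeas G y) +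
        C\<^sup>2 / 2 * ((m y)\<^sup>2 * vmeas G y) + t * (\<bar>h y\<bar> * vmeas G y)"
      by (simp only: minus_minus distrib_right mult.assoc)
  qed
  also have "\<dots> = 1 / (2 * C\<^sup>2) * (\<Sum>y\<in>A. (g y)\<^sup>2 * vmeas G y) + C\<^sup>2 / 2 * N +
      t * (\<Sum>y\<in>A. \<bar>h y\<bar> * vmeas G y)"
    unfolding N_def by (simp only: sum.distrib sum_distrib_left)
  also have "\<dots> \<le> 1 / (2 * C\<^sup>2) * I + C\<^sup>2 / 2 * N + t * J"
    using gI hJ t0 by (intro add_mono mult_left_mono) auto
  finally have CN: "C\<^sup>2 * N \<le> I / C\<^sup>2 + 2 * (t * J)"
    by (simp add: field_simps)
  have "(m x)\<^sup>2 * vmeas G x \<le> N"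
    unfolding N_def using A \<mu> by (intro member_le_sum) auto
  then have "C\<^sup>2 * (t\<^sup>2 * vmeas G x) \<le> C\<^sup>2 * N"
    unfolding mx by (intro mult_left_mono) auto
  with CN have quad: "C\<^sup>2 * (t\<^sup>2 * vmeas G x) \<le> I / C\<^sup>2 + 2 * (t * J)"
    by linarith
  have den: "0 < C\<^sup>2 * vmeas G x"
    using C vmeas_pos[OF x] by simp
  have quot: "0 \<le> (I / C\<^sup>2 + 2 * J) / (C\<^sup>2 * vmeas G x)"
    using den I0 J0 by (intro divide_nonneg_pos add_nonneg_nonneg) auto
  have "t \<le> 1 + (I / C\<^sup>2 + 2 * J) / (C\<^sup>2 * vmeas G x)"
  proof (cases "t \<le> 1")
    case False
    then have "I / C\<^sup>2 \<le> t * (I / C\<^sup>2)"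
      using mult_right_mono[of 1 t "I / C\<^sup>2"] I0 by simp
    then have "t * (t * (C\<^sup>2 * vmeas G x)) \<le> t * (I / C\<^sup>2 + 2 * J)"
      using quad by (simp add: power2_eq_square algebra_simps)
    then have "t * (C\<^sup>2 * vmeas G x) \<le> I / C\<^sup>2 + 2 * J"
      using False by simp
    then have "t \<le> (I / C\<^sup>2 + 2 * J) / (C\<^sup>2 * vmeas G x)"
      using den by (simp only: pos_le_divide_eq)
    then show ?thesis by simp
  qed (use quot in simp)
  then show ?thesis
    by (simp only: t_def I_def J_def)
qed

section \<open>Solving the Kazdan-Warner equation\<close>

lemma nbrs_nonempty:
  assumes "connected_graph G" "infinite (verts G)" "x \<in> verts G"
  shows "nbrs G x \<noteq> {}"
proof -
  have "verts G - {x} \<noteq> {}"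
    using assms(2) by (metis finite.emptyI finite_Diff2 finite_insert)
  then obtain y where "y \<in> verts G" "y \<noteq> x"
    by blast
  then have "(x, y) \<in> (edges G)\<^sup>*" "y \<noteq> x"
    using assms by (auto simp: connected_graph_def)
  then show ?thesis
    by (auto simp: nbrs_def elim: converse_rtranclE)
qed

end

theorem theorem2p4:
  fixes G :: "'a wgraph" and g h :: "'a \<Rightarrow> real"
  assumes "weighted_graph G"
    and "connected_graph G"
    and "infinite (verts G)"
    and "locally_finite_graph G"
    and "(h \<in> Lp 1 G \<and> (\<forall>x\<in>verts G. g x \<le> h x \<and> h x < 0) \<and>
            vintegrable G (\<lambda>x. (g x / h x)\<^sup>2 * \<bar>h x\<bar>))
         \<or> (cheeger_graph G \<and> g \<in> Lp 2 G \<and> h \<in> Lp 1 G \<and> (\<forall>x\<in>verts G. h x \<le> 0))"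
  shows "\<exists>f :: 'a \<Rightarrow> real. \<forall>x\<in>verts G. laplacian G f x + h x * exp (f x) - g x = 0"
proof -
  interpret locally_finite_weighted_graph G
    by standard (fact assms)+
  define F where "F x t = g x - h x * exp t" for x t
  have cont: "continuous_on UNIV (F x)" for x
    unfolding F_def by (intro continuous_intros)
  from assms(5) have "\<exists>f. \<forall>x\<in>verts G. laplacian G f x = F x (f x)"
  proof (elim disjE conjE)
    assume gh: "\<forall>x\<in>verts G. g x \<le> h x \<and> h x < 0"
      and int: "vintegrable G (\<lambda>x. (g x / h x)\<^sup>2 * \<bar>h x\<bar>)"
    have "\<exists>u. \<forall>x\<in>verts G. 0 \<le> u x \<and> laplacian G u x = F x (u x)"
    proof (rule solution_from_finite_subsolutions[OF cont])
      show "F x 0 \<le> 0" if "x \<in> verts G" for x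
        using gh that by (simp add: F_def)
      show "\<exists>B. \<forall>f\<in>finite_subsolutions F. f x \<le> B" if "x \<in> verts G" for x
        using exp_subsolution_bound[OF _ int _ that] gh unfolding F_def by blast
    qed
    then show ?thesis by blast
  next
    assume "cheeger_graph G" and g: "g \<in> Lp 2 G" and h: "h \<in> Lp 1 G"
      and h0: "\<forall>x\<in>verts G. h x \<le> 0"
    then obtain W C where W: "exhaustion G W" "C > 0"
      and cheeger: "\<And>k m. \<exists>x\<in>vclosure G (W k). m x \<noteq> 0 \<Longrightarrow> \<forall>x\<in>vboundary G (W k). m x = 0 \<Longrightarrow>
        (let H = full_subgraph G (vclosure G (W k))
         in Lp_norm 2 H (grad_modulus H m) > C * Lp_norm 2 H m)"
      unfolding cheeger_graph_def by blast
    have g2: "vintegrable G (\<lambda>x. (g x)\<^sup>2)" and h1: "vintegrable G (\<lambda>x. \<bar>h x\<bar>)"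
      using g h by (simp_all add: Lp_def)
    have "\<exists>u. \<forall>x\<in>verts G. 0 \<le> u x \<and> laplacian G u x = - (\<bar>g x\<bar> + \<bar>h x\<bar>)"
    proof (rule solution_from_finite_subsolutions[where F = "\<lambda>x t. - (\<bar>g x\<bar> + \<bar>h x\<bar>)"])
      show "\<exists>B. \<forall>f\<in>finite_subsolutions (\<lambda>x t. - (\<bar>g x\<bar> + \<bar>h x\<bar>)). f x \<le> B"
        if "x \<in> verts G" for x
        using poisson_subsolution_bound[OF W cheeger g2 h1 _ that] by blast
    qed auto
    then obtain u where u: "0 \<le> u x" "laplacian G u x = - (\<bar>g x\<bar> + \<bar>h x\<bar>)"
      if "x \<in> verts G" for x
      by blast
    show ?thesis
    proof (rule solution_between[OF cont])
      show "mono (F x)" if "x \<in> verts G" for x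
        using h0 that by (intro monoI) (simp add: F_def mult_left_mono_neg)
      show "nbrs G x \<noteq> {}" if "x \<in> verts G" for x
        using nbrs_nonempty assms(2,3) that .
      show "subsolution F (\<lambda>x. - u x)"
        unfolding subsolution_def
      proof
        fix x assume x: "x \<in> verts G"
        have "laplacian G (\<lambda>x. - u x) x = - laplacian G u x"
          unfolding laplacian_def mult_minus_right[symmetric] sum_negf[symmetric]
          by (simp add: algebra_simps)
        moreover have "\<bar>h x\<bar> * exp (- u x) \<le> \<bar>h x\<bar>"
          using u(1)[OF x] by (intro mult_left_le) auto
        ultimately show "F x (- u x) \<le> laplacian G (\<lambda>x. - u x) x"
          using u(2)[OF x] h0 x by (simp add: F_def abs_of_nonpos)
      qed
      show "laplacian G u x \<le> F x (u x)" if x: "x \<in> verts G" for x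
      proof -
        have "h x * exp (u x) \<le> 0"
          using h0 x by (simp add: mult_nonpos_nonneg)
        then show ?thesis
          using u(2)[OF x] by (simp add: F_def)
      qed
      show "- u x \<le> u x" if "x \<in> verts G" for x
        using u(1)[OF that] by simp
    qed
  qed
  then obtain f where "\<forall>x\<in>verts G. laplacian G f x = F x (f x)"
    by blast
  then have "\<forall>x\<in>verts G. laplacian G f x + h x * exp (f x) - g x = 0"
    by (simp add: F_def)
  then show ?thesis by blast
qed

end
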